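(* The lattice $L=U+A_2+2E_8+A_1$ is achiral, i.e., for some cell $P$ of $\Lambda(L)$ there is an automorphism $g$ of $L$ with $g(P)=P$ which is $P$-reversing and $\mathbb{Z}/3$-direct.
   Context: $U$ has Gram matrix $\begin{pmatrix}0&1\\1&0\end{pmatrix}$; $A_1,A_2,E_8$ are positive definite root lattices; $+$ denotes orthogonal sum. For $L$: $V_k=\{v\in L:v^2=k,\ 2vw/v^2\in\mathbb{Z}\ \forall w\in L\}$ ($k=2,6$); $\Lambda(L)=\{x\in L\otimes\mathbb{R}:x^2<0\}/\mathbb{R}^*$; cells are closures of components of the complement of the hyperplanes $v^\perp$, $v\in V_2\cup V_6$. A cell $P$ lifts to two opposite pieces $\pm P^\sharp$ in $\{x^2<0\}/\mathbb{R}_{>0}$; $g$ with $g(P)=P$ is $P$-reversing if $g(P^\sharp)=-P^\sharp$. $g$ is $\mathbb{Z}/3$-direct if it acts trivially on the $3$-primary part ($\cong\mathbb{Z}/3$) of the discriminant group $L^*/L$. *)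

theory Defs
  imports "HOL-Analysis.Analysis" "HOL-Library.Numeral_Type"
begin

text \<open>The lattice L = U + A2 + 2 E8 + A1 (rank 21) is modelled as the integer points
  of real^21, with coordinates indexed 0..20 (via idx) in the basis
  U: 0,1;  A2: 2,3;  first E8: 4..11;  second E8: 12..19;  A1: 20.\<close>

definition idx :: "21 \<Rightarrow> nat" where
  "idx i = nat (Rep_bit1 i)"

text \<open>Cartan matrix (positive definite root lattice Gram matrix) given by the edge set of the
  Dynkin diagram.\<close>
definition cartan :: "(nat \<times> nat) set \<Rightarrow> nat \<Rightarrow> nat \<Rightarrow> int" where
  "cartan E i j = (if i = j then 2 else if (i, j) \<in> E \<or> (j, i) \<in> E then -1 else 0)"

text \<open>E8 Dynkin diagram, Bourbaki numbering 1..8 shifted to 0..7: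
  edges 1-3, 2-4, 3-4, 4-5, 5-6, 6-7, 7-8.\<close>
definition E8_edges :: "(nat \<times> nat) set" where
  "E8_edges = {(0,2), (1,3), (2,3), (3,4), (4,5), (5,6), (6,7)}"

definition A2_edges :: "(nat \<times> nat) set" where
  "A2_edges = {(0,1)}"

definition gramL :: "nat \<Rightarrow> nat \<Rightarrow> int" where
  "gramL i j =
    (if i < 2 \<and> j < 2 then (if i \<noteq> j then 1 else 0)
     else if 2 \<le> i \<and> i < 4 \<and> 2 \<le> j \<and> j < 4 then cartan A2_edges (i - 2) (j - 2)
     else if 4 \<le> i \<and> i < 12 \<and> 4 \<le> j \<and> j < 12 then cartan E8_edges (i - 4) (j - 4)
     else if 12 \<le> i \<and> i < 20 \<and> 12 \<le> j \<and> j < 20 then cartan E8_edges (i - 12) (j - 12)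
     else if i = 20 \<and> j = 20 then 2
     else 0)"

text \<open>The bilinear form on L \<otimes> R = real^21.\<close>
definition bil :: "real^21 \<Rightarrow> real^21 \<Rightarrow> real" where
  "bil x y = (\<Sum>i\<in>UNIV. \<Sum>j\<in>UNIV. x $ i * of_int (gramL (idx i) (idx j)) * y $ j)"

definition latL :: "(real^21) set" where
  "latL = {x. \<forall>i. x $ i \<in> \<int>}"

text \<open>V_k = {v in L : v^2 = k, 2 v.w / v^2 in Z for all w in L}.\<close>
definition Vk :: "real \<Rightarrow> (real^21) set" where
  "Vk k = {v \<in> latL. bil v v = k \<and> (\<forall>w\<in>latL. 2 * bil v w / bil v v \<in> \<int>)}"

text \<open>The negative cone {x^2 < 0}; Lambda(L) is its quotient by R^*.  We work on the cone:
  cells of Lambda(L) correspond to pairs \<open>\<pm>P#\<close> of lifted cells in the cone.\<close>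
definition negcone :: "(real^21) set" where
  "negcone = {x. bil x x < 0}"

definition walls :: "(real^21) set" where
  "walls = (\<Union>v \<in> Vk 2 \<union> Vk 6. {x. bil v x = 0})"

text \<open>A lifted cell P#: closure (within the cone) of a connected component of the complement
  of the walls.\<close>
definition lifted_cell :: "(real^21) set \<Rightarrow> bool" where
  "lifted_cell Q \<longleftrightarrow>
     (\<exists>x \<in> negcone - walls. Q = closure (connected_component_set (negcone - walls) x) \<inter> negcone)"

text \<open>Automorphisms of L, represented by their matrices acting on real^21.\<close>
definition autL :: "real^21^21 \<Rightarrow> bool" where
  "autL M \<longleftrightarrow> (\<lambda>x. M *v x) ` latL = latL \<and> (\<forall>x y. bil (M *v x) (M *v y) = bil x y)"

definition dualL :: "(real^21) set" where
  "dualL = {y. \<forall>w\<in>latL. bil y w \<in> \<int>}"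

text \<open>Representatives of the 3-primary part of L*/L.\<close>
definition dual3 :: "(real^21) set" where
  "dual3 = {y \<in> dualL. \<exists>k::nat. (3 ^ k) *\<^sub>R y \<in> latL}"

definition Z3_direct :: "real^21^21 \<Rightarrow> bool" where
  "Z3_direct M \<longleftrightarrow> (\<forall>y\<in>dual3. M *v y - y \<in> latL)"

end

theory Submission
  imports Defs
begin

text \<open>An explicit involution \<open>g\<close> of \<open>L\<close>, given by its integer matrix, does the job.
  Its fixed sublattice has all norms divisible by 4, so no vector of \<open>V\<^sub>2 \<union> V\<^sub>6\<close> is
  fixed by \<open>g\<close>; hence no wall \<open>v\<^sup>\<perp>\<close> contains the \<open>(-1)\<close>-eigenspace of \<open>g\<close>, which meets
  the negative cone.  A generic point \<open>x\<close> of the eigenspace in the cone therefore lies on no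
  wall, and \<open>g\<close> maps the cell through \<open>x\<close> onto the cell through \<open>g x = -x\<close>, i.e. onto its
  negative.  Finally \<open>2(g - 1)\<close> maps \<open>L\<^sup>*\<close> into \<open>L\<close> while \<open>3\<close> kills the 3-primary part of
  \<open>L\<^sup>*/L\<close>, so \<open>g\<close> acts trivially on that part.\<close>

section \<open>Matrices and involutions\<close>

lemma inner_transpose_right:
  fixes A :: "real^'n^'m"
  shows "(A *v x) \<bullet> y = x \<bullet> (transpose A *v y)"
  by (metis dot_lmul_matrix transpose_matrix_vector transpose_transpose)

lemma continuous_on_matrix_vector_mult [continuous_intros]:
  fixes A :: "real^'n^'m"
  shows "continuous_on S f \<Longrightarrow> continuous_on S (\<lambda>x. A *v f x)"
  by (rule continuous_on_compose2[of UNIV "(*v) A" S f])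
    (auto intro: matrix_vector_mult_linear_continuous_on)

lemma involution_apply: "M ** M = mat 1 \<Longrightarrow> M *v (M *v x) = x"
  by (simp add: matrix_vector_mul_assoc)

lemma involution_image_eq:
  assumes "\<And>x. f (f x) = x" "f ` A \<subseteq> A"
  shows "f ` A = A"
proof
  show "A \<subseteq> f ` A" using assms by (metis image_eqI image_subset_iff subsetI)
qed (fact assms(2))

section \<open>Coordinates\<close>

lemma idx_less: "idx i < 21"
proof -
  have "Rep_bit1 i \<in> {0..<1 + 2 * int CARD(10)}"
    by (rule Rep_bit1)
  then show ?thesis unfolding idx_def by (simp add: nat_less_iff)
qed

definition idx_inv :: "nat \<Rightarrow> 21" where "idx_inv k = Abs_bit1 (int k)"

lemma idx_idx_inv: "k < 21 \<Longrightarrow> idx (idx_inv k) = k"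
  unfolding idx_def idx_inv_def by (simp add: Abs_bit1_inverse)

lemma idx_inv_idx: "idx_inv (idx i) = i"
proof -
  have "Rep_bit1 i \<in> {0..<1 + 2 * int CARD(10)}"
    by (rule Rep_bit1)
  then show ?thesis unfolding idx_def idx_inv_def by (simp add: Rep_bit1_inverse)
qed

lemma idx_eq_iff: "idx i = idx j \<longleftrightarrow> i = j"
  by (metis idx_inv_idx)

lemma sum_UNIV_21: "(\<Sum>i\<in>UNIV. f i) = (\<Sum>k<21. f (idx_inv k))"
proof -
  have "bij_betw idx_inv {..<21} UNIV"
    by (rule bij_betwI[where g=idx]) (auto simp: idx_idx_inv idx_inv_idx idx_less)
  from sum.reindex_bij_betw[OF this, of f] show ?thesis by simp
qed

section \<open>Integer matrices given as lists\<close>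

text \<open>Matrix identities between explicit integer matrices are checked on lists by
  evaluation and then transferred to \<open>real^21^21\<close> along \<open>mat_of\<close>.\<close>

definition mat_of :: "int list list \<Rightarrow> real^21^21" where
  "mat_of A = (\<chi> i j. of_int (A ! idx i ! idx j))"

definition vec_of :: "int list \<Rightarrow> real^21" where
  "vec_of v = (\<chi> i. of_int (v ! idx i))"

definition lmult :: "int list list \<Rightarrow> int list list \<Rightarrow> int list list" where
  "lmult A B = map (\<lambda>i. map (\<lambda>j. \<Sum>k\<leftarrow>[0..<21]. A!i!k * B!k!j) [0..<21]) [0..<21]"

definition lmult_vec :: "int list list \<Rightarrow> int list \<Rightarrow> int list" where
  "lmult_vec A v = map (\<lambda>i. \<Sum>k\<leftarrow>[0..<21]. A!i!k * v!k) [0..<21]"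

definition ldot :: "int list \<Rightarrow> int list \<Rightarrow> int" where
  "ldot u v = (\<Sum>k\<leftarrow>[0..<21]. u!k * v!k)"

definition lid :: "int list list" where
  "lid = map (\<lambda>i. map (\<lambda>j. if i = j then 1 else 0) [0..<21]) [0..<21]"

definition ltranspose :: "int list list \<Rightarrow> int list list" where
  "ltranspose A = map (\<lambda>i. map (\<lambda>j. A!j!i) [0..<21]) [0..<21]"

definition ladd :: "int list list \<Rightarrow> int list list \<Rightarrow> int list list" where
  "ladd A B = map (\<lambda>i. map (\<lambda>j. A!i!j + B!i!j) [0..<21]) [0..<21]"

definition ldiff :: "int list list \<Rightarrow> int list list \<Rightarrow> int list list" where
  "ldiff A B = map (\<lambda>i. map (\<lambda>j. A!i!j - B!i!j) [0..<21]) [0..<21]"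

definition lscale :: "int \<Rightarrow> int list list \<Rightarrow> int list list" where
  "lscale c A = map (\<lambda>i. map (\<lambda>j. c * A!i!j) [0..<21]) [0..<21]"

lemma mat_of_nth: "mat_of A $ i $ j = of_int (A ! idx i ! idx j)"
  by (simp add: mat_of_def)

lemma vec_of_nth: "vec_of v $ i = of_int (v ! idx i)"
  by (simp add: vec_of_def)

lemma sum_list_upt_21: "(\<Sum>k\<leftarrow>[0..<21]. f k) = (\<Sum>k<21. f k)"
  by (simp add: sum_list_sum_nth atLeast0LessThan)

lemma mat_of_lmult: "mat_of A ** mat_of B = mat_of (lmult A B)"
  by (simp add: vec_eq_iff matrix_matrix_mult_def mat_of_nth lmult_def idx_less sum_UNIV_21
      idx_idx_inv sum_list_upt_21)

lemma mat_of_lmult_vec: "mat_of A *v vec_of v = vec_of (lmult_vec A v)"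
  by (simp add: vec_eq_iff matrix_vector_mult_def mat_of_nth vec_of_nth lmult_vec_def idx_less
      sum_UNIV_21 idx_idx_inv sum_list_upt_21)

lemma inner_vec_of: "vec_of u \<bullet> vec_of v = of_int (ldot u v)"
  by (simp add: inner_vec_def vec_of_nth ldot_def sum_UNIV_21 idx_idx_inv sum_list_upt_21)

lemma mat_of_lid: "mat_of lid = mat 1"
  by (simp add: vec_eq_iff mat_of_nth lid_def idx_less mat_def idx_eq_iff)

lemma mat_of_ltranspose: "mat_of (ltranspose A) = transpose (mat_of A)"
  by (simp add: vec_eq_iff mat_of_nth ltranspose_def idx_less transpose_def)

lemma mat_of_ladd: "mat_of (ladd A B) = mat_of A + mat_of B"
  by (simp add: vec_eq_iff mat_of_nth ladd_def idx_less)

lemma mat_of_ldiff: "mat_of (ldiff A B) = mat_of A - mat_of B"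
  by (simp add: vec_eq_iff mat_of_nth ldiff_def idx_less)

lemma mat_of_lscale: "mat_of (lscale c A) *v x = of_int c *\<^sub>R (mat_of A *v x)"
  by (simp add: vec_eq_iff mat_of_nth lscale_def idx_less matrix_vector_mult_def
      sum_distrib_left mult.assoc)

lemma mat_of_latL: "x \<in> latL \<Longrightarrow> mat_of A *v x \<in> latL"
  by (auto simp: latL_def matrix_vector_mult_def mat_of_nth intro!: Ints_mult)

lemma inner_mat_of_latL: "x \<in> latL \<Longrightarrow> y \<in> latL \<Longrightarrow> x \<bullet> (mat_of A *v y) \<in> \<int>"
  using mat_of_latL[of y A] by (auto simp: inner_vec_def latL_def intro!: Ints_mult)

section \<open>The certificates\<close>

text \<open>\<open>M_list\<close> is the matrix of the involution \<open>g\<close>; \<open>G6inv_list\<close> is \<open>6 G\<^sup>-\<^sup>1\<close> for the Gram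
  matrix \<open>G\<close>; \<open>C_list\<close> witnesses \<open>(g - 1) 6 G\<^sup>-\<^sup>1 \<in> 3 M\<^sub>2\<^sub>1(\<int>)\<close>; \<open>Q_list\<close> is an integral
  endomorphism fixing every \<open>g\<close>-invariant vector, and \<open>D_list\<close> exhibits the pulled-back form
  \<open>Q\<^sup>T G Q\<close> as \<open>2(D + D\<^sup>T)\<close>; \<open>x0_list\<close> is a \<open>g\<close>-anti-invariant vector of norm \<open>-2\<close>.\<close>

definition gram_list :: "int list list" where
  "gram_list = map (\<lambda>i. map (\<lambda>j. gramL i j) [0..<21]) [0..<21]"

definition M_list :: "int list list" where "M_list = [[-13, 12, -12, 12, 0, 0, 0, 0, 0, -3, 0, 0, 3, 0, 0, 0, 0, 0, -6, 0, 0], [12, -13, 12, -12, 0, 0, 0, 0, 0, 3, 0, 0, -3, 0, 0, 0, 0, 0, 6, 0, 0], [4, -4, 3, -4, 0, 0, 0, 0, 0, 1, 0, 0, -1, 0, 0, 0, 0, 0, 2, 0, 0], [-4, 4, -4, 3, 0, 0, 0, 0, 0, -1, 0, 0, 1, 0, 0, 0, 0, 0, -2, 0, 0], [18, -18, 18, -18, 0, 0, 0, 0, 0, 4, 0, 0, -4, 0, 0, 0, 0, -1, 10, 0, 0], [27, -27, 27, -27, 0, 0, 0, 0, 0, 6, 0, 0, -6, -1, 0, 0, 0, 0, 14, 0, 0], [36, -36, 36, -36, 0, 0, 0, 0, 0, 8, 0, 0, -8, 0, 0, 0, -1, 0, 19, 0, 0], [54, -54, 54, -54, 0, 0, 0,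 0, 0, 12, 0, 0, -12, 0, 0, -1, 0, 0, 28, 0, 0], [45, -45, 45, -45, 0, 0, 0, 0, 0, 10, 0, 0, -10, 0, -1, 0, 0, 0, 23, 0, 0], [36, -36, 36, -36, 0, 0, 0, 0, 0, 8, 0, 0, -9, 0, 0, 0, 0, 0, 18, 0, 0], [24, -24, 24, -24, 0, 0, 0, 0, 0, 6, -1, 0, -6, 0, 0, 0, 0, 0, 12, 0, 0], [12, -12, 12, -12, 0, 0, 0, 0, 0, 3, 0, -1, -3, 0, 0, 0, 0, 0, 6, 0, 0], [12, -12, 12, -12, 0, 0, 0, 0, 0, 3, 0, 0, -4, 0, 0, 0, 0, 0, 6, 0, 0], [21, -21, 21, -21, 0, -1, 0, 0, 0, 6, 0, 0, -6, 0, 0, 0, 0, 0, 10, 0, 0], [27, -27, 27, -27, 0, 0, 0, 0, -1, 8, 0, 0, -8, 0, 0, 0, 0, 0, 13, 0, 0], [42, -42, 42, -42, 0, 0, 0, -1, 0, 12, 0, 0, -12, 0, 0, 0, 0, 0, 20, 0, 0], [36, -36, 36, -36, 0, 0, -1, 0, 0, 10, 0, 0, -10, 0, 0, 0, 0, 0, 17, 0, 0], [30, -30, 30, -30, -1, 0, 0, 0, 0, 8, 0, 0, -8, 0, 0, 0, 0, 0, 14, 0, 0], [24, -24, 24, -24, 0, 0, 0, 0, 0, 6, 0, 0, -6, 0, 0, 0, 0, 0, 11, 0, 0], [12, -12, 12, -12, 0, 0, 0, 0, 0, 3, 0, 0, -3, 0, 0, 0, 0, 0, 6, -1, 0], [0,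 0, 0, 0, 0, 0, 0, 0, 0, 0, 0, 0, 0, 0, 0, 0, 0, 0, 0, 0, -1]]"
definition Q_list :: "int list list" where "Q_list = [[0, 0, -3, 0, 0, 0, 0, 0, 0, 0, 0, 0, 0, 0, 0, 0, 0, 0, 0, 0, 0], [0, 0, 3, 0, 0, 0, 0, 0, 0, 0, 0, 0, 0, 0, 0, 0, 0, 0, 0, 0, 0], [0, 0, 1, 0, 0, 0, 0, 0, 0, 0, 0, 0, 0, 0, 0, 0, 0, 0, 0, 0, 0], [0, 0, -1, 0, 0, 0, 0, 0, 0, 0, 0, 0, 0, 0, 0, 0, 0, 0, 0, 0, 0], [0, 0, 0, 0, 1, 0, 0, 0, 0, 0, 0, 0, 0, 0, 0, 0, 0, 0, 0, 0, 0], [0, 0, 0, 0, 0, 1, 0, 0, 0, 0, 0, 0, 0, 0, 0, 0, 0, 0, 0, 0, 0], [0, 0, 0, 0, 0, 0, 1, 0, 0, 0, 0, 0, 0, 0, 0, 0, 0, 0, 0, 0, 0], [0, 0, 0, 0, 0, 0, 0, 1, 0, 0, 0, 0, 0, 0, 0, 0, 0, 0, 0, 0, 0], [0, 0, 0, 0, 0, 0, 0, 0, 1, 0, 0, 0, 0, 0, 0, 0, 0, 0, 0, 0, 0], [0, 0, 9, 0, 0, 0, 0, 0, 0, 0, 0, 0, 0, 0, 0, 0, 0, 0, 0, 0, 0], [0, 0, 6, 0, 0, 0, 0, 0, 0, 0, 0, 0, 0, 0, 0, 0, 0, 0, 0, 0, 0], [0, 0, 3, 0, 0, 0, 0, 0,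 0, 0, 0, 0, 0, 0, 0, 0, 0, 0, 0, 0, 0], [0, 0, 3, 0, 0, 0, 0, 0, 0, 0, 0, 0, 0, 0, 0, 0, 0, 0, 0, 0, 0], [0, 0, 12, 0, 0, -1, 0, 0, 0, 0, 0, 0, 0, 0, 0, 0, 0, 0, 0, 0, 0], [0, 0, 18, 0, 0, 0, 0, 0, -1, 0, 0, 0, 0, 0, 0, 0, 0, 0, 0, 0, 0], [0, 0, 24, 0, 0, 0, 0, -1, 0, 0, 0, 0, 0, 0, 0, 0, 0, 0, 0, 0, 0], [0, 0, 18, 0, 0, 0, -1, 0, 0, 0, 0, 0, 0, 0, 0, 0, 0, 0, 0, 0, 0], [0, 0, 12, 0, -1, 0, 0, 0, 0, 0, 0, 0, 0, 0, 0, 0, 0, 0, 0, 0, 0], [0, 0, 6, 0, 0, 0, 0, 0, 0, 0, 0, 0, 0, 0, 0, 0, 0, 0, 0, 0, 0], [0, 0, 3, 0, 0, 0, 0, 0, 0, 0, 0, 0, 0, 0, 0, 0, 0, 0, 0, 0, 0], [0, 0, 0, 0, 0, 0, 0, 0, 0, 0, 0, 0, 0, 0, 0, 0, 0, 0, 0, 0, 0]]"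
definition G6inv_list :: "int list list" where "G6inv_list = [[0, 6, 0, 0, 0, 0, 0, 0, 0, 0, 0, 0, 0, 0, 0, 0, 0, 0, 0, 0, 0], [6, 0, 0, 0, 0, 0, 0, 0, 0, 0, 0, 0, 0, 0, 0, 0, 0, 0, 0, 0, 0], [0, 0, 4, 2, 0, 0, 0, 0, 0, 0, 0, 0, 0, 0, 0, 0, 0, 0, 0, 0, 0], [0, 0, 2, 4, 0, 0, 0, 0, 0, 0, 0, 0, 0, 0, 0, 0, 0, 0, 0, 0, 0], [0, 0, 0, 0, 24, 30, 42, 60, 48, 36, 24, 12, 0, 0, 0, 0, 0, 0, 0, 0, 0], [0, 0, 0, 0, 30, 48, 60, 90, 72, 54, 36, 18, 0, 0, 0, 0, 0, 0, 0, 0, 0], [0, 0, 0, 0, 42, 60, 84, 120, 96, 72, 48, 24, 0, 0, 0, 0, 0, 0, 0, 0, 0], [0, 0, 0, 0, 60, 90, 120, 180, 144, 108, 72, 36, 0, 0, 0, 0, 0, 0, 0, 0, 0], [0, 0, 0, 0, 48, 72, 96, 144, 120, 90, 60, 30, 0, 0, 0, 0, 0, 0, 0, 0, 0], [0, 0, 0, 0, 36, 54, 72, 108, 90, 72, 48, 24, 0, 0, 0, 0, 0, 0, 0, 0, 0], [0, 0, 0, 0, 24, 36, 48, 72, 60, 48, 36, 18, 0, 0, 0, 0, 0, 0, 0, 0, 0], [0, 0, 0, 0, 12, 18, 24, 36, 30, 24, 18, 12, 0, 0, 0, 0, 0, 0, 0, 0, 0], [0, 0, 0, 0, 0, 0,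 0, 0, 0, 0, 0, 0, 24, 30, 42, 60, 48, 36, 24, 12, 0], [0, 0, 0, 0, 0, 0, 0, 0, 0, 0, 0, 0, 30, 48, 60, 90, 72, 54, 36, 18, 0], [0, 0, 0, 0, 0, 0, 0, 0, 0, 0, 0, 0, 42, 60, 84, 120, 96, 72, 48, 24, 0], [0, 0, 0, 0, 0, 0, 0, 0, 0, 0, 0, 0, 60, 90, 120, 180, 144, 108, 72, 36, 0], [0, 0, 0, 0, 0, 0, 0, 0, 0, 0, 0, 0, 48, 72, 96, 144, 120, 90, 60, 30, 0], [0, 0, 0, 0, 0, 0, 0, 0, 0, 0, 0, 0, 36, 54, 72, 108, 90, 72, 48, 24, 0], [0, 0, 0, 0, 0, 0, 0, 0, 0, 0, 0, 0, 24, 36, 48, 72, 60, 48, 36, 18, 0], [0, 0, 0, 0, 0, 0, 0, 0, 0, 0, 0, 0, 12, 18, 24, 36, 30, 24, 18, 12, 0], [0, 0, 0, 0, 0, 0, 0, 0, 0, 0, 0, 0, 0, 0, 0, 0, 0, 0, 0, 0, 3]]"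
definition C_list :: "int list list" where "C_list = [[24, -28, -8, 8, -36, -54, -72, -108, -90, -72, -48, -24, -24, -42, -54, -84, -72, -60, -48, -24, 0], [-28, 24, 8, -8, 36, 54, 72, 108, 90, 72, 48, 24, 24, 42, 54, 84, 72, 60, 48, 24, 0], [-8, 8, 0, -4, 12, 18, 24, 36, 30, 24, 16, 8, 8, 14, 18, 28, 24, 20, 16, 8, 0], [8, -8, -4, 0, -12, -18, -24, -36, -30, -24, -16, -8, -8, -14, -18, -28, -24, -20, -16, -8, 0], [-36, 36, 12, -12, 40, 62, 82, 124, 104, 84, 56, 28, 36, 62, 80, 124, 106, 88, 72, 36, 0], [-54, 54, 18, -18, 62, 92, 124, 186, 156, 126, 84, 42, 54, 92, 120, 186, 160, 134, 108, 54, 0], [-72, 72, 24, -24, 82, 124, 164, 248, 208, 168, 112, 56, 72, 124, 160, 248, 212, 178, 144, 72, 0], [-108, 108, 36, -36, 124, 186, 248, 372, 312, 252, 168, 84, 108, 186, 240, 372, 320, 268, 216, 108, 0], [-90, 90, 30, -30, 104, 156, 208, 312, 260, 210, 140, 70, 90, 156, 200, 312, 268, 224, 180, 90, 0], [-72, 72, 24, -24, 84, 126, 168, 252, 210, 168, 112, 56, 72, 126, 162, 252, 216, 180, 144, 72, 0], [-48, 48, 16, -16, 56, 84, 112, 168, 140, 112, 72, 36, 48, 84, 108, 168, 144, 120, 96, 48, 0], [-24, 24, 8, -8, 28, 42, 56, 84, 70, 56, 36, 16, 24, 42, 54, 84, 72, 60, 48, 24, 0], [-24, 24, 8, -8, 36,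 54, 72, 108, 90, 72, 48, 24, 8, 22, 26, 44, 40, 36, 32, 16, 0], [-42, 42, 14, -14, 62, 92, 124, 186, 156, 126, 84, 42, 22, 44, 56, 90, 80, 70, 60, 30, 0], [-54, 54, 18, -18, 80, 120, 160, 240, 200, 162, 108, 54, 26, 56, 68, 112, 100, 88, 76, 38, 0], [-84, 84, 28, -28, 124, 186, 248, 372, 312, 252, 168, 84, 44, 90, 112, 180, 160, 140, 120, 60, 0], [-72, 72, 24, -24, 106, 160, 212, 320, 268, 216, 144, 72, 40, 80, 100, 160, 140, 122, 104, 52, 0], [-60, 60, 20, -20, 88, 134, 178, 268, 224, 180, 120, 60, 36, 70, 88, 140, 122, 104, 88, 44, 0], [-48, 48, 16, -16, 72, 108, 144, 216, 180, 144, 96, 48, 32, 60, 76, 120, 104, 88, 72, 36, 0], [-24, 24, 8, -8, 36, 54, 72, 108, 90, 72, 48, 24, 16, 30, 38, 60, 52, 44, 36, 16, 0], [0, 0, 0, 0, 0, 0, 0, 0, 0, 0, 0, 0, 0, 0, 0, 0, 0, 0, 0, 0, -2]]"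
definition D_list :: "int list list" where "D_list = [[0, 0, 0, 0, 0, 0, 0, 0, 0, 0, 0, 0, 0, 0, 0, 0, 0, 0, 0, 0, 0], [0, 0, 0, 0, 0, 0, 0, 0, 0, 0, 0, 0, 0, 0, 0, 0, 0, 0, 0, 0, 0], [0, 0, 51, 0, 0, 0, 0, 0, -9, 0, 0, 0, 0, 0, 0, 0, 0, 0, 0, 0, 0], [0, 0, 0, 0, 0, 0, 0, 0, 0, 0, 0, 0, 0, 0, 0, 0, 0, 0, 0, 0, 0], [0, 0, 0, 0, 1, 0, -1, 0, 0, 0, 0, 0, 0, 0, 0, 0, 0, 0, 0, 0, 0], [0, 0, 0, 0, 0, 1, 0, -1, 0, 0, 0, 0, 0, 0, 0, 0, 0, 0, 0, 0, 0], [0, 0, 0, 0, 0, 0, 1, -1, 0, 0, 0, 0, 0, 0, 0, 0, 0, 0, 0, 0, 0], [0, 0, 0, 0, 0, 0, 0, 1, -1, 0, 0, 0, 0, 0, 0, 0, 0, 0, 0, 0, 0], [0, 0, 0, 0, 0, 0, 0, 0, 1, 0, 0, 0, 0, 0, 0, 0, 0, 0, 0, 0, 0], [0, 0, 0, 0, 0, 0, 0, 0, 0, 0, 0, 0, 0, 0, 0, 0, 0, 0, 0, 0, 0], [0, 0, 0, 0, 0, 0, 0, 0, 0, 0, 0, 0, 0, 0, 0, 0, 0, 0, 0, 0, 0], [0, 0, 0, 0, 0, 0, 0, 0, 0, 0, 0, 0, 0, 0, 0, 0, 0, 0, 0, 0, 0], [0, 0, 0, 0, 0, 0, 0, 0,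 0, 0, 0, 0, 0, 0, 0, 0, 0, 0, 0, 0, 0], [0, 0, 0, 0, 0, 0, 0, 0, 0, 0, 0, 0, 0, 0, 0, 0, 0, 0, 0, 0, 0], [0, 0, 0, 0, 0, 0, 0, 0, 0, 0, 0, 0, 0, 0, 0, 0, 0, 0, 0, 0, 0], [0, 0, 0, 0, 0, 0, 0, 0, 0, 0, 0, 0, 0, 0, 0, 0, 0, 0, 0, 0, 0], [0, 0, 0, 0, 0, 0, 0, 0, 0, 0, 0, 0, 0, 0, 0, 0, 0, 0, 0, 0, 0], [0, 0, 0, 0, 0, 0, 0, 0, 0, 0, 0, 0, 0, 0, 0, 0, 0, 0, 0, 0, 0], [0, 0, 0, 0, 0, 0, 0, 0, 0, 0, 0, 0, 0, 0, 0, 0, 0, 0, 0, 0, 0], [0, 0, 0, 0, 0, 0, 0, 0, 0, 0, 0, 0, 0, 0, 0, 0, 0, 0, 0, 0, 0], [0, 0, 0, 0, 0, 0, 0, 0, 0, 0, 0, 0, 0, 0, 0, 0, 0, 0, 0, 0, 0]]"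
definition x0_list :: "int list" where "x0_list = [-6, 6, 2, -2, 8, 12, 16, 24, 20, 16, 11, 6, 8, 12, 16, 24, 20, 16, 12, 6, 0]"

lemma M_list_involution: "lmult M_list M_list = lid" by code_simp
lemma M_list_isometry: "lmult (ltranspose M_list) (lmult gram_list M_list) = gram_list"
  by code_simp
lemma gram_list_symmetric: "ltranspose gram_list = gram_list" by code_simp
lemma G6inv_list_gram: "lmult G6inv_list gram_list = lscale 6 lid" by code_simp
lemma M_list_dual: "lmult (ldiff M_list lid) G6inv_list = lscale 3 C_list" by code_simp
lemma Q_list_gram:
  "lmult (ltranspose Q_list) (lmult gram_list Q_list) = lscale 2 (ladd D_list (ltranspose D_list))"
  by code_simp
lemma Q_list_fixed: "lmult (ldiff lid Q_list) (ldiff M_list lid) = lscale (-2) (ldiff lid Q_list)"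
  by code_simp
lemma x0_list_antifixed: "lmult_vec M_list x0_list = map uminus x0_list" by code_simp
lemma x0_list_norm: "ldot x0_list (lmult_vec gram_list x0_list) = -2" by code_simp

section \<open>The bilinear form\<close>

definition gram :: "real^21^21" where "gram = mat_of gram_list"

lemma bil_gram: "bil x y = x \<bullet> (gram *v y)"
  by (simp add: bil_def gram_def inner_vec_def matrix_vector_mult_def mat_of_nth gram_list_def
      idx_less sum_distrib_left mult.assoc)

lemma transpose_gram: "transpose gram = gram"
  by (metis gram_def gram_list_symmetric mat_of_ltranspose)

lemma bil_commute: "bil x y = bil y x"
proof -
  have "x \<bullet> (gram *v y) = (gram *v y) \<bullet> x" by (rule inner_commute)
  also have "\<dots> = y \<bullet> (gram *v x)" by (simp add: inner_transpose_right transpose_gram)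
  finally show ?thesis by (simp add: bil_gram)
qed

lemma bil_gram_left: "bil x y = (gram *v x) \<bullet> y"
proof -
  have "bil x y = bil y x" by (rule bil_commute)
  also have "\<dots> = (gram *v x) \<bullet> y" by (simp add: bil_gram inner_commute)
  finally show ?thesis .
qed

lemma bil_scaleR_right: "bil x (c *\<^sub>R y) = c * bil x y"
  by (simp add: bil_gram matrix_vector_mult_scaleR)

lemma bil_diff_right: "bil x (y - z) = bil x y - bil x z"
  by (simp add: bil_gram matrix_vector_mult_diff_distrib inner_diff_right)

lemma bil_minus_right: "bil x (- y) = - bil x y"
  using bil_diff_right[of x 0 y] by (simp add: bil_gram)

lemma bil_minus_minus: "bil (- x) (- y) = bil x y"
  using bil_commute[of "- x" y] bil_commute[of y x] by (simp add: bil_minus_right)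

lemma scaleR_6_gram_inverse: "6 *\<^sub>R y = mat_of G6inv_list *v (gram *v y)"
proof -
  have "mat_of G6inv_list *v (gram *v y) = mat_of (lscale 6 lid) *v y"
    by (simp add: gram_def matrix_vector_mul_assoc mat_of_lmult G6inv_list_gram)
  also have "\<dots> = 6 *\<^sub>R y" by (simp add: mat_of_lscale mat_of_lid)
  finally show ?thesis by simp
qed

lemma gram_mult_eq_0: "gram *v w = 0 \<Longrightarrow> w = 0"
  using scaleR_6_gram_inverse[of w] by simp

section \<open>The lattice and its dual\<close>

lemma latL_diff: "x \<in> latL \<Longrightarrow> y \<in> latL \<Longrightarrow> x - y \<in> latL"
  by (auto simp: latL_def)

lemma latL_uminus: "uminus ` latL = latL"
proof -
  have "- x \<in> latL" if "x \<in> latL" for x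
    using that by (auto simp: latL_def)
  then show ?thesis by (intro involution_image_eq) auto
qed

lemma countable_latL: "countable latL"
proof (rule countable_subset)
  show "latL \<subseteq> range (\<lambda>f::21 \<Rightarrow> int. \<chi> i. of_int (f i))"
  proof
    fix x assume "x \<in> latL"
    then show "x \<in> range (\<lambda>f::21 \<Rightarrow> int. \<chi> i. of_int (f i))"
      by (intro image_eqI[where x="\<lambda>i. \<lfloor>x $ i\<rfloor>"]) (simp_all add: vec_eq_iff latL_def)
  qed
qed simp

lemma gram_dualL: "y \<in> dualL \<Longrightarrow> gram *v y \<in> latL"
proof -
  assume y: "y \<in> dualL"
  have "(gram *v y) $ i = bil (axis i 1) y" for i
    by (simp add: bil_gram inner_axis')
  moreover have "bil (axis i 1) y \<in> \<int>" for i
  proof -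
    have "axis i 1 \<in> latL" by (simp add: latL_def axis_def)
    then show ?thesis using y by (simp add: dualL_def bil_commute[of _ y])
  qed
  ultimately show ?thesis by (simp add: latL_def)
qed

lemma three_times_Ints:
  fixes t :: real
  assumes six: "6 * t \<in> \<int>" and pow3: "3 ^ k * t \<in> \<int>"
  shows "3 * t \<in> \<int>"
proof (cases k)
  case 0
  then show ?thesis using pow3 by simp
next
  case (Suc k')
  from six obtain a where a: "6 * t = of_int a" by (metis Ints_cases)
  from pow3 obtain b where b: "3 ^ k * t = of_int b" by (metis Ints_cases)
  have "(of_int (3 ^ k * a) :: real) = 6 * (3 ^ k * t)" using a by simp
  also have "\<dots> = of_int (6 * b)" using b by simp
  finally have "3 ^ k * a = 2 * (3 * b)" by (simp only: of_int_eq_iff)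
  then have "(2::int) dvd 3 ^ k * a" by simp
  moreover have "coprime (2::int) (3 ^ k)" by simp
  ultimately obtain c where "a = 2 * c" using coprime_dvd_mult_right_iff by blast
  then have "3 * t = of_int c" using a by simp
  then show ?thesis by simp
qed

text \<open>\<open>6 L\<^sup>* \<subseteq> L\<close>, so the 3-primary part of \<open>L\<^sup>*/L\<close> is killed by 3.\<close>

lemma scaleR_3_dual3: "y \<in> dual3 \<Longrightarrow> 3 *\<^sub>R y \<in> latL"
proof -
  assume y: "y \<in> dual3"
  then obtain k :: nat where k: "3 ^ k *\<^sub>R y \<in> latL" and "y \<in> dualL"
    by (auto simp: dual3_def)
  then have "6 *\<^sub>R y \<in> latL"
    unfolding scaleR_6_gram_inverse using mat_of_latL gram_dualL by blast
  then show ?thesis using k three_times_Ints by (auto simp: latL_def)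
qed

lemma Z3_directI:
  assumes "autL M" and twice: "\<And>y. y \<in> dualL \<Longrightarrow> 2 *\<^sub>R (M *v y - y) \<in> latL"
  shows "Z3_direct M"
  unfolding Z3_direct_def
proof
  fix y assume y: "y \<in> dual3"
  define d where "d = M *v y - y"
  have "3 *\<^sub>R d = M *v (3 *\<^sub>R y) - 3 *\<^sub>R y"
    by (simp add: d_def matrix_vector_mult_scaleR algebra_simps)
  moreover have "M *v (3 *\<^sub>R y) \<in> latL"
    using \<open>autL M\<close> scaleR_3_dual3[OF y] by (auto simp: autL_def)
  ultimately have "3 *\<^sub>R d \<in> latL" using latL_diff scaleR_3_dual3[OF y] by simp
  moreover have "2 *\<^sub>R d \<in> latL" using twice y by (simp add: d_def dual3_def)
  ultimately have "3 *\<^sub>R d - 2 *\<^sub>R d \<in> latL" by (rule latL_diff)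
  moreover have "3 *\<^sub>R d - 2 *\<^sub>R d = d" by (simp flip: scaleR_left_diff_distrib)
  ultimately show "M *v y - y \<in> latL" by (simp add: d_def)
qed

section \<open>Involutive automorphisms and cells\<close>

lemma autL_Vk:
  assumes M: "autL M" and v: "v \<in> Vk k"
  shows "M *v v \<in> Vk k"
proof -
  have "2 * bil (M *v v) w / bil (M *v v) (M *v v) \<in> \<int>" if "w \<in> latL" for w
  proof -
    from that M have "w \<in> (*v) M ` latL" by (simp add: autL_def)
    then obtain w' where "w' \<in> latL" "w = M *v w'" by blast
    then show ?thesis using M v by (auto simp: autL_def Vk_def)
  qed
  then show ?thesis using assms by (auto simp: autL_def Vk_def)
qed

lemma autL_involution_adjoint:
  assumes "autL M" "M ** M = mat 1"
  shows "bil (M *v x) y = bil x (M *v y)"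
  using assms by (metis autL_def involution_apply)

lemma autL_involution_cone_walls:
  assumes M: "autL M" "M ** M = mat 1" and x: "x \<in> negcone - walls"
  shows "M *v x \<in> negcone - walls"
proof -
  have "M *v x \<notin> walls"
  proof
    assume "M *v x \<in> walls"
    then obtain v where v: "v \<in> Vk 2 \<union> Vk 6" and "bil v (M *v x) = 0"
      by (auto simp: walls_def)
    then have "bil (M *v v) x = 0" using autL_involution_adjoint[OF M] by simp
    moreover have "M *v v \<in> Vk 2 \<union> Vk 6" using v autL_Vk[OF M(1)] by blast
    ultimately show False using x by (auto simp: walls_def)
  qed
  then show ?thesis using M x by (simp add: autL_def negcone_def)
qed

lemma autL_involution_image_cell:
  fixes M :: "real^21^21"
  defines "S \<equiv> negcone - walls"
  assumes M: "autL M" "M ** M = mat 1" and x: "x \<in> S"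
  shows "(*v) M ` (closure (connected_component_set S x) \<inter> negcone)
       = closure (connected_component_set S (M *v x)) \<inter> negcone"
proof -
  have inj: "inj ((*v) M)" by (metis M(2) injI involution_apply)
  have "homeomorphism S S ((*v) M) ((*v) M)"
    using autL_involution_cone_walls[OF M] M(2)
    by (intro homeomorphismI)
      (auto simp: S_def involution_apply matrix_vector_mult_linear_continuous_on)
  then have cc: "(*v) M ` connected_component_set S x = connected_component_set S (M *v x)"
    using x by (simp add: connected_component_set_homeomorphism)
  have "(*v) M ` negcone = negcone"
    using M by (intro involution_image_eq) (auto simp: negcone_def autL_def involution_apply)
  then show ?thesis
    by (simp add: image_Int[OF inj] closure_injective_linear_image[OF matrix_vector_mul_linear inj] cc)
qed

lemma minus_mat_1_apply: "(- mat 1 :: real^21^21) *v x = - x"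
  using matrix_vector_mult_diff_rdistrib[of 0 "mat 1" x] by simp

lemma autL_minus_mat_1: "autL (- mat 1)"
  by (simp add: autL_def minus_mat_1_apply latL_uminus bil_minus_minus)

lemma minus_mat_1_square: "(- mat 1 :: real^21^21) ** (- mat 1) = mat 1"
  by (simp add: matrix_eq minus_mat_1_apply matrix_vector_mul_assoc[symmetric])

definition antiproj :: "real^21^21 \<Rightarrow> real^21 \<Rightarrow> real^21" where
  "antiproj M z = (1/2) *\<^sub>R (z - M *v z)"

lemma antiproj_antifixed: "M ** M = mat 1 \<Longrightarrow> M *v antiproj M z = - antiproj M z"
  by (simp add: antiproj_def matrix_vector_mult_scaleR matrix_vector_mult_diff_distrib
      involution_apply algebra_simps)

lemma bil_antiproj:
  assumes "autL M" "M ** M = mat 1"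
  shows "bil v (antiproj M z) = bil (antiproj M v) z"
proof -
  have "bil v (antiproj M z) = (1/2) * (bil v z - bil (M *v v) z)"
    by (simp add: antiproj_def bil_scaleR_right bil_diff_right autL_involution_adjoint[OF assms])
  also have "\<dots> = bil z (antiproj M v)"
    by (simp add: antiproj_def bil_scaleR_right bil_diff_right bil_commute[of z])
  finally show ?thesis by (simp add: bil_commute[of z])
qed

text \<open>A wall \<open>v\<^sup>\<perp>\<close> pulls back along \<open>antiproj M\<close> to the hyperplane orthogonal to
  \<open>G (v - M v)\<close>, a genuine hyperplane when \<open>M v \<noteq> v\<close>.  Countably many hyperplanes cannot
  cover the nonempty open set of points projecting into the negative cone.\<close>

lemma antifixed_point_off_walls:
  assumes M: "autL M" "M ** M = mat 1"
    and no_fixed: "\<And>v. v \<in> Vk 2 \<union> Vk 6 \<Longrightarrow> M *v v \<noteq> v"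
    and x0: "M *v x0 = - x0" "bil x0 x0 < 0"
  shows "\<exists>x \<in> negcone - walls. M *v x = - x"
proof -
  define H where "H v = {z. (gram *v antiproj M v) \<bullet> z = 0}" for v
  define S where "S = {z. bil (antiproj M z) (antiproj M z) < 0}"
  have "countable (Vk 2 \<union> Vk 6)"
    using countable_latL by (rule countable_subset[rotated]) (auto simp: Vk_def)
  moreover have "negligible (H v)" if "v \<in> Vk 2 \<union> Vk 6" for v
  proof -
    have "antiproj M v \<noteq> 0" using no_fixed[OF that] by (auto simp: antiproj_def)
    then show ?thesis unfolding H_def using gram_mult_eq_0 by (intro negligible_hyperplane) auto
  qed
  ultimately have "negligible (\<Union>v \<in> Vk 2 \<union> Vk 6. H v)"
    by (intro negligible_countable_Union) auto
  moreover have "\<not> negligible S"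
  proof -
    have "open S" unfolding S_def antiproj_def
      by (rule open_Collect_less) (auto simp: bil_gram intro!: continuous_intros)
    moreover have "x0 \<in> S" using x0 by (simp add: S_def antiproj_def)
    ultimately show ?thesis using open_not_negligible by blast
  qed
  ultimately obtain z where z: "z \<in> S" "z \<notin> (\<Union>v \<in> Vk 2 \<union> Vk 6. H v)"
    using negligible_subset by blast
  have "antiproj M z \<notin> walls"
    using z(2) by (auto simp: walls_def H_def bil_antiproj[OF M] bil_gram_left[symmetric])
  moreover have "antiproj M z \<in> negcone" using z(1) by (simp add: S_def negcone_def)
  ultimately show ?thesis using antiproj_antifixed[OF M(2)] by blast
qed

section \<open>The involution \<open>g\<close>\<close>

definition achiral_involution :: "real^21^21" where
  "achiral_involution = mat_of M_list"

lemma achiral_involution_square: "achiral_involution ** achiral_involution = mat 1"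
  by (simp add: achiral_involution_def mat_of_lmult M_list_involution mat_of_lid)

lemma achiral_involution_isometry:
  "bil (achiral_involution *v x) (achiral_involution *v y) = bil x y"
proof -
  have "transpose achiral_involution ** gram ** achiral_involution
      = mat_of (ltranspose M_list) ** (mat_of gram_list ** mat_of M_list)"
    by (simp add: achiral_involution_def gram_def mat_of_ltranspose matrix_mul_assoc)
  also have "\<dots> = gram"
    by (simp only: mat_of_lmult M_list_isometry gram_def)
  finally show ?thesis
    by (simp add: bil_gram inner_transpose_right matrix_vector_mul_assoc matrix_mul_assoc)
qed

lemma achiral_involution_autL: "autL achiral_involution"
proof -
  have "achiral_involution *v x \<in> latL" if "x \<in> latL" for x
    using that by (simp add: achiral_involution_def mat_of_latL)
  then have "(*v) achiral_involution ` latL = latL"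
    using achiral_involution_square by (intro involution_image_eq) (auto simp: involution_apply)
  then show ?thesis by (simp add: autL_def achiral_involution_isometry)
qed

lemma achiral_involution_Z3_direct: "Z3_direct achiral_involution"
proof (rule Z3_directI[OF achiral_involution_autL])
  fix y assume "y \<in> dualL"
  define d where "d = achiral_involution *v y - y"
  have "d = mat_of (ldiff M_list lid) *v y"
    by (simp add: d_def achiral_involution_def mat_of_ldiff mat_of_lid
        matrix_vector_mult_diff_rdistrib)
  then have "6 *\<^sub>R d = mat_of (ldiff M_list lid) *v (6 *\<^sub>R y)"
    by (simp add: matrix_vector_mult_scaleR)
  also have "\<dots> = mat_of (lscale 3 C_list) *v (gram *v y)"
    by (simp only: scaleR_6_gram_inverse mat_of_lmult M_list_dual
        matrix_vector_mul_assoc[of "mat_of (ldiff M_list lid)" "mat_of G6inv_list"])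
  also have "\<dots> = 3 *\<^sub>R (mat_of C_list *v (gram *v y))" by (simp add: mat_of_lscale)
  finally have six_d: "6 *\<^sub>R d = 3 *\<^sub>R (mat_of C_list *v (gram *v y))" .
  have "2 *\<^sub>R d = (1/3) *\<^sub>R (6 *\<^sub>R d)" by simp
  also have "\<dots> = mat_of C_list *v (gram *v y)" using six_d by simp
  finally have "2 *\<^sub>R d = mat_of C_list *v (gram *v y)" .
  then show "2 *\<^sub>R (achiral_involution *v y - y) \<in> latL"
    using mat_of_latL gram_dualL[OF \<open>y \<in> dualL\<close>] by (simp add: d_def)
qed

lemma achiral_involution_fixed_imp_Q_list_fixed:
  assumes "achiral_involution *v v = v"
  shows "mat_of Q_list *v v = v"
proof -
  have "mat_of (ldiff M_list lid) *v v = 0"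
    using assms by (simp add: mat_of_ldiff mat_of_lid achiral_involution_def
        matrix_vector_mult_diff_rdistrib)
  then have "0 = mat_of (ldiff lid Q_list) *v (mat_of (ldiff M_list lid) *v v)" by simp
  also have "\<dots> = mat_of (lscale (-2) (ldiff lid Q_list)) *v v"
    by (simp only: matrix_vector_mul_assoc mat_of_lmult Q_list_fixed)
  also have "\<dots> = (-2) *\<^sub>R (v - mat_of Q_list *v v)"
    by (simp add: mat_of_lscale mat_of_ldiff mat_of_lid matrix_vector_mult_diff_rdistrib)
  finally show ?thesis by simp
qed

lemma achiral_involution_fixed_norm:
  assumes v: "v \<in> latL" and fixed: "achiral_involution *v v = v"
  shows "\<exists>n::int. bil v v = 4 * of_int n"
proof -
  define Q where "Q = mat_of Q_list"
  define D where "D = mat_of D_list"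
  have "bil v v = (Q *v v) \<bullet> (gram *v (Q *v v))"
    using achiral_involution_fixed_imp_Q_list_fixed[OF fixed] by (simp add: bil_gram Q_def)
  also have "\<dots> = v \<bullet> ((mat_of (ltranspose Q_list) ** (mat_of gram_list ** mat_of Q_list)) *v v)"
    by (simp add: inner_transpose_right Q_def gram_def mat_of_ltranspose matrix_vector_mul_assoc)
  also have "\<dots> = v \<bullet> (mat_of (lscale 2 (ladd D_list (ltranspose D_list))) *v v)"
    by (simp only: mat_of_lmult Q_list_gram)
  also have "\<dots> = 2 * (v \<bullet> (D *v v) + v \<bullet> (transpose D *v v))"
    by (simp add: mat_of_lscale mat_of_ladd mat_of_ltranspose D_def
        matrix_vector_mult_add_rdistrib inner_add_right)
  also have "v \<bullet> (transpose D *v v) = v \<bullet> (D *v v)"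
    by (metis inner_transpose_right transpose_transpose inner_commute)
  finally have "bil v v = 4 * (v \<bullet> (D *v v))" by simp
  moreover obtain n where "v \<bullet> (D *v v) = of_int n"
    using inner_mat_of_latL[OF v v] by (metis D_def Ints_cases)
  ultimately show ?thesis by auto
qed

lemma achiral_involution_fixes_no_wall_vector:
  assumes "v \<in> Vk 2 \<union> Vk 6"
  shows "achiral_involution *v v \<noteq> v"
proof
  assume "achiral_involution *v v = v"
  moreover from assms have v: "v \<in> latL" and "bil v v = 2 \<or> bil v v = 6"
    by (auto simp: Vk_def)
  ultimately obtain n :: int where "4 * of_int n = (2::real) \<or> 4 * of_int n = (6::real)"
    using achiral_involution_fixed_norm by metis
  then have "4 * n = 2 \<or> 4 * n = 6" by linarith
  then show False by presburger
qed

lemma achiral_involution_antifixed_vector: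
  "achiral_involution *v vec_of x0_list = - vec_of x0_list"
  "bil (vec_of x0_list) (vec_of x0_list) = -2"
proof -
  have "achiral_involution *v vec_of x0_list = vec_of (map uminus x0_list)"
    by (simp add: achiral_involution_def mat_of_lmult_vec x0_list_antifixed)
  also have "\<dots> = - vec_of x0_list"
  proof -
    have "length x0_list = 21" by (simp add: x0_list_def)
    then show ?thesis by (simp add: vec_eq_iff vec_of_nth idx_less)
  qed
  finally show "achiral_involution *v vec_of x0_list = - vec_of x0_list" .
  show "bil (vec_of x0_list) (vec_of x0_list) = -2"
    by (simp add: bil_gram gram_def mat_of_lmult_vec inner_vec_of x0_list_norm)
qed

section \<open>Achirality\<close>

theorem corollary7p7p2:
  shows "\<exists>Q M. lifted_cell Q \<and> autL M
           \<and> (\<lambda>x. M *v x) ` (Q \<union> uminus ` Q) = Q \<union> uminus ` Q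
           \<and> (\<lambda>x. M *v x) ` Q = uminus ` Q
           \<and> Z3_direct M"
proof -
  let ?g = achiral_involution and ?S = "negcone - walls"
  obtain x where x: "x \<in> ?S" and gx: "?g *v x = - x"
    using antifixed_point_off_walls[OF achiral_involution_autL achiral_involution_square
        achiral_involution_fixes_no_wall_vector achiral_involution_antifixed_vector(1)]
      achiral_involution_antifixed_vector(2) by auto
  define Q where "Q = closure (connected_component_set ?S x) \<inter> negcone"
  have "lifted_cell Q" unfolding lifted_cell_def Q_def using x by blast
  moreover have gQ: "(*v) ?g ` Q = uminus ` Q"
    using autL_involution_image_cell[OF achiral_involution_autL achiral_involution_square x]
      autL_involution_image_cell[OF autL_minus_mat_1 minus_mat_1_square x]
    by (simp add: Q_def gx minus_mat_1_apply)
  moreover have "(*v) ?g ` uminus ` Q = Q"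
    using achiral_involution_square by (simp flip: gQ add: image_image involution_apply)
  ultimately show ?thesis
    using achiral_involution_autL achiral_involution_Z3_direct
    by (intro exI[of _ Q] exI[of _ ?g]) (auto simp: image_Un)
qed

end
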